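(* Let $K_1 = \{p_1, \ldots, p_n\} \subset \mathbb{R}^d$ and $K_2 = \{q_1, \ldots, q_m\} \subset \mathbb{R}^d$ be finite sets ($n$ and $m$ points, respectively) such that $K_2$ is contained in the interior of $\operatorname{conv}(K_1)$. Then there exists a projective transformation $\phi$, admissible with respect to $K_1$ (and hence with respect to $K_2$), such that \[ \frac1n \sum_{i=1}^n \phi(p_i) = \frac1m \sum_{j=1}^m \phi(q_j). \] In general, $\phi$ is not unique, even up to post-composition with affine transformations: there exist $d$, finite sets $K_1 = \{p_1, \ldots, p_n\} \subset \mathbb{R}^d$ and $K_2 = \{q_1, \ldots, q_m\} \subset \mathbb{R}^d$ ($n$ and $m$ points, respectively) with $K_2$ contained in the interior of $\operatorname{conv}(K_1)$, and two projective transformations $\phi, \psi$, admissible with respect to $K_1$ and satisfying $\frac1n \sum_{i=1}^n \phi(p_i) = \frac1m \sum_{j=1}^m \phi(q_j)$ and $\frac1n \sum_{i=1}^n \psi(p_i) = \frac1m \sum_{j=1}^m \psi(q_j)$, such that $\phi \circ \psi^{-1}$ is not affine.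
   Context: $\mathbb{R}^d$ is identified with the affine chart $\{(x_0 : x_1 : \cdots : x_d) \mid x_0 \neq 0\}$ of $\mathbb{R}\mathrm{P}^d$. A projective transformation $\phi$ of $\mathbb{R}\mathrm{P}^d$ is admissible for $K \subset \mathbb{R}^d$ if $\phi(\operatorname{conv}(K)) \subset \mathbb{R}^d$; it is affine if it restricts to a map $x \mapsto Ax+b$ of $\mathbb{R}^d$, $A \in \mathrm{GL}(d)$. *)

theory Defs
  imports "HOL-Analysis.Analysis" "HOL-Analysis.Finite_Function_Topology"
begin

text \<open>
  The dimension \<open>d\<close> is existentially quantified in part of the theorem, so it has to be a natural
  number rather than a type.  All spaces therefore live inside the normed space of finitely
  supported real sequences: \<open>\<real>\<^sup>d\<close> consists of the vectors with coordinates \<open>x\<^sub>1, \<dots>, x\<^sub>d\<close>, and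
  the space of homogeneous coordinates \<open>\<real>\<^sup>d\<^sup>+\<^sup>1\<close> has the additional coordinate \<open>x\<^sub>0\<close>.
  The norm of the ambient type is the sum norm, which induces the usual topology on both.
\<close>

type_synonym vec = "nat \<Rightarrow>\<^sub>0 real"

definition Rd :: "nat \<Rightarrow> vec set" where
  "Rd d = {x. Poly_Mapping.keys x \<subseteq> {1..d}}"

definition homogeneous :: "nat \<Rightarrow> vec set" where
  "homogeneous d = {x. Poly_Mapping.keys x \<subseteq> {0..d}}"

text \<open>Points of \<open>\<real>P\<^sup>d\<close> are the lines through the origin.\<close>

definition RP :: "nat \<Rightarrow> vec set set" where
  "RP d = {span {v} |v. v \<in> homogeneous d \<and> v \<noteq> 0}"

text \<open>The point \<open>(1 : x\<^sub>1 : \<dots> : x\<^sub>d)\<close>:\<close>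

definition chart :: "vec \<Rightarrow> vec set" where
  "chart x = span {Poly_Mapping.single 0 1 + x}"

text \<open>
  Projective transformations are functions on lines, of which only the values on \<open>RP d\<close> matter.
  The linear map is defined on the whole ambient type, which is no restriction, since every
  linear automorphism of \<open>homogeneous d\<close> extends (by the identity on the other coordinates).
  The same remark applies to \<open>A \<in> GL(d)\<close> in the definition of affine maps below.
\<close>

definition projective_transformation :: "nat \<Rightarrow> (vec set \<Rightarrow> vec set) \<Rightarrow> bool" where
  "projective_transformation d \<phi> \<longleftrightarrow>
     (\<exists>A. linear A \<and> bij_betw A (homogeneous d) (homogeneous d) \<and> (\<forall>P \<in> RP d. \<phi> P = A ` P))"

definition admissible :: "nat \<Rightarrow> (vec set \<Rightarrow> vec set) \<Rightarrow> vec set \<Rightarrow> bool" where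
  "admissible d \<phi> K \<longleftrightarrow> \<phi> ` chart ` (convex hull K) \<subseteq> chart ` Rd d"

definition affine_transformation :: "nat \<Rightarrow> (vec set \<Rightarrow> vec set) \<Rightarrow> bool" where
  "affine_transformation d \<phi> \<longleftrightarrow>
     (\<exists>A b. linear A \<and> bij_betw A (Rd d) (Rd d) \<and> b \<in> Rd d \<and>
        (\<forall>x \<in> Rd d. \<phi> (chart x) = chart (A x + b)))"

text \<open>
  The value \<open>\<phi>(x)\<close> as a point of \<open>\<real>\<^sup>d\<close>; meaningful only if \<open>\<phi> (chart x)\<close> lies in the affine chart.
\<close>

definition affine_value :: "nat \<Rightarrow> (vec set \<Rightarrow> vec set) \<Rightarrow> vec \<Rightarrow> vec" where
  "affine_value d \<phi> x = inv_into (Rd d) chart (\<phi> (chart x))"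

definition image_mean :: "nat \<Rightarrow> (vec set \<Rightarrow> vec set) \<Rightarrow> vec set \<Rightarrow> vec" where
  "image_mean d \<phi> K = (1 / real (card K)) *\<^sub>R (\<Sum>p\<in>K. affine_value d \<phi> p)"

text \<open>
  The interior is taken in \<open>\<real>\<^sup>d\<close>.  The set \<open>K\<^sub>2\<close> has to be nonempty for its mean to make sense,
  and then so is \<open>K\<^sub>1\<close>.
\<close>

definition nested_sets :: "nat \<Rightarrow> vec set \<Rightarrow> vec set \<Rightarrow> bool" where
  "nested_sets d K1 K2 \<longleftrightarrow>
     finite K1 \<and> K1 \<subseteq> Rd d \<and> finite K2 \<and> K2 \<subseteq> Rd d \<and> K2 \<noteq> {} \<and>
     K2 \<subseteq> (top_of_set (Rd d)) interior_of (convex hull K1)"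

lemma lookup_scaleR: "Poly_Mapping.lookup (c *\<^sub>R x) i = c *\<^sub>R Poly_Mapping.lookup x i"
proof -
  have "finite {j. c *\<^sub>R Poly_Mapping.lookup x j \<noteq> 0}"
    by (rule finite_subset[OF _ finite_lookup[of x]]) auto
  then show ?thesis by (simp add: scaleR_poly_mapping_def)
qed

lemma lookup_0_Rd:
  assumes "x \<in> Rd d"
  shows "Poly_Mapping.lookup x 0 = 0"
proof -
  have "0 \<notin> Poly_Mapping.keys x"
    using assms subsetD[of "Poly_Mapping.keys x" "{1..d}" 0] by (auto simp: Rd_def)
  then show ?thesis by (simp add: in_keys_iff)
qed

lemma inj_on_chart: "inj_on chart (Rd d)"
proof (rule inj_onI)
  fix x y assume xy: "x \<in> Rd d" "y \<in> Rd d" and eq: "chart x = chart y"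
  have x0: "Poly_Mapping.lookup x 0 = 0" and y0: "Poly_Mapping.lookup y 0 = 0"
    using xy lookup_0_Rd by blast+
  have "Poly_Mapping.single 0 1 + x \<in> chart y"
    using eq span_base[of _ "{Poly_Mapping.single 0 1 + x}"] by (auto simp: chart_def)
  then obtain k where k: "Poly_Mapping.single 0 1 + x = k *\<^sub>R (Poly_Mapping.single 0 1 + y)"
    unfolding chart_def span_singleton by blast
  have "k = 1"
    using arg_cong[OF k, of "\<lambda>v. Poly_Mapping.lookup v 0"] x0 y0
    by (simp add: lookup_add lookup_scaleR)
  then show "x = y" using k by (simp only: scaleR_one add_left_cancel)
qed

lemma chart_image:
  "chart ` Rd d = {span {v} |v. v \<in> homogeneous d \<and> Poly_Mapping.lookup v 0 \<noteq> 0}"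
proof (intro equalityI subsetI)
  fix P assume "P \<in> chart ` Rd d"
  then obtain x where x: "x \<in> Rd d" "P = chart x" by (elim imageE)
  let ?v = "Poly_Mapping.single 0 1 + x"
  have "Poly_Mapping.keys x \<subseteq> {0..d}"
    using x(1) unfolding Rd_def mem_Collect_eq by (rule subset_trans) simp
  moreover have "Poly_Mapping.keys (Poly_Mapping.single 0 (1::real)) \<subseteq> {0..d}"
    by (simp del: single_one)
  ultimately have "?v \<in> homogeneous d"
    unfolding homogeneous_def mem_Collect_eq by (meson keys_add Un_least subset_trans)
  moreover have "Poly_Mapping.lookup ?v 0 \<noteq> 0"
    using lookup_0_Rd[OF x(1)] by (simp add: lookup_add)
  moreover have "P = span {?v}" using x(2) by (simp add: chart_def)
  ultimately show "P \<in> {span {v} |v. v \<in> homogeneous d \<and> Poly_Mapping.lookup v 0 \<noteq> 0}"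
    by blast
next
  fix P assume "P \<in> {span {v} |v. v \<in> homogeneous d \<and> Poly_Mapping.lookup v 0 \<noteq> 0}"
  then obtain v where v: "P = span {v}" "Poly_Mapping.keys v \<subseteq> {0..d}"
    and v0: "Poly_Mapping.lookup v 0 \<noteq> 0" unfolding homogeneous_def by blast
  define c where "c = Poly_Mapping.lookup v 0"
  define x where "x = (1 / c) *\<^sub>R v - Poly_Mapping.single 0 1"
  have c: "c \<noteq> 0" using v0 by (simp add: c_def)
  have "i \<in> {1..d}" if "Poly_Mapping.lookup x i \<noteq> 0" for i
  proof -
    have "i \<noteq> 0" using that c by (cases "i = 0") (simp_all add: x_def lookup_minus lookup_scaleR c_def)
    moreover from this have "i \<in> Poly_Mapping.keys v"
      using that by (auto simp: x_def lookup_minus lookup_scaleR in_keys_iff lookup_single simp del: single_one)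
    ultimately show ?thesis using subsetD[OF v(2)] by simp
  qed
  then have "x \<in> Rd d" unfolding Rd_def in_keys_iff subset_iff by blast
  moreover have "chart x = P"
  proof -
    have "Poly_Mapping.single 0 1 + x = (1 / c) *\<^sub>R v" by (simp add: x_def)
    then have "chart x = span {(1 / c) *\<^sub>R v}" by (simp add: chart_def)
    also have "\<dots> = span {v}"
      using span_image_scale[of "{v}" "\<lambda>_. 1 / c"] c by simp
    finally show ?thesis using v(1) by simp
  qed
  ultimately show "P \<in> chart ` Rd d" by blast
qed

lemma projective_transformation_bij:
  assumes "projective_transformation d \<phi>"
  shows "bij_betw \<phi> (RP d) (RP d)"
proof -
  obtain A where A: "linear A" "bij_betw A (homogeneous d) (homogeneous d)"
    and \<phi>: "\<And>P. P \<in> RP d \<Longrightarrow> \<phi> P = A ` P"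
    using assms unfolding projective_transformation_def by blast
  have inj: "inj_on A (homogeneous d)" and im: "A ` homogeneous d = homogeneous d"
    using A(2) by (auto simp: bij_betw_def)
  have zero: "0 \<in> homogeneous d" by (simp add: homogeneous_def)
  have nz: "A v \<noteq> 0 \<longleftrightarrow> v \<noteq> 0" if "v \<in> homogeneous d" for v
    using inj_onD[OF inj _ that zero] linear_0[OF A(1)] by auto
  have val: "\<phi> (span {v}) = span {A v}" if "v \<in> homogeneous d" "v \<noteq> 0" for v
  proof -
    have "span {v} \<in> RP d" using that unfolding RP_def by blast
    then show ?thesis using \<phi> linear_span_image[OF A(1), of "{v}"] by simp
  qed
  have sub: "P \<subseteq> homogeneous d" if P: "P \<in> RP d" for P
  proof -
    have "c *\<^sub>R v \<in> homogeneous d" if "v \<in> homogeneous d" for c v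
      using that by (auto simp: homogeneous_def subset_iff in_keys_iff lookup_scaleR)
    moreover obtain v where "v \<in> homogeneous d" "P = span {v}"
      using P unfolding RP_def by blast
    ultimately show ?thesis unfolding span_singleton by blast
  qed
  have "inj_on \<phi> (RP d)"
  proof (rule inj_onI)
    fix P Q assume PQ: "P \<in> RP d" "Q \<in> RP d" and "\<phi> P = \<phi> Q"
    then have "A ` P = A ` Q" using \<phi> by simp
    then show "P = Q" using inj_on_image_eq_iff[OF inj sub sub] PQ by simp
  qed
  moreover have "\<phi> ` RP d = RP d"
  proof (intro equalityI subsetI)
    fix Q assume "Q \<in> \<phi> ` RP d"
    then obtain v where v: "v \<in> homogeneous d" "v \<noteq> 0" "Q = \<phi> (span {v})"
      unfolding RP_def by blast
    then have "A v \<in> homogeneous d" "A v \<noteq> 0" "Q = span {A v}"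
      using nz val im by blast+
    then show "Q \<in> RP d" unfolding RP_def by blast
  next
    fix Q assume "Q \<in> RP d"
    then obtain w where w: "w \<in> homogeneous d" "w \<noteq> 0" "Q = span {w}"
      unfolding RP_def by blast
    then obtain v where v: "v \<in> homogeneous d" "w = A v" using im by blast
    then have "v \<noteq> 0" using w nz by blast
    then have "Q = \<phi> (span {v})" "span {v} \<in> RP d"
      using v w val unfolding RP_def by blast+
    then show "Q \<in> \<phi> ` RP d" by blast
  qed
  ultimately show ?thesis by (simp add: bij_betw_def)
qed

end

theory Submission
  imports Defs
begin

text \<open>
  Up to an affine map, a projective transformation is \<open>x \<mapsto> (x - c) / \<alpha>(1, x)\<close>, where the linear
  functional \<open>\<alpha>\<close> on homogeneous coordinates is its denominator.  It is admissible for \<open>K\<^sub>1\<close> as soon as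
  \<open>\<alpha>\<close> is positive at the points \<open>(1, p)\<close> with \<open>p \<in> K\<^sub>1\<close>, and it makes the two means equal if
  \[ \frac1n \sum_i \frac{(1, p_i)}{\alpha(1, p_i)} = \frac1m \sum_j \frac{(1, q_j)}{\alpha(1, q_j)}. \]
  This is the equation for a critical point of
  \[ \frac1n \sum_i \ln \alpha(1, p_i) - \frac1m \sum_j \ln \alpha(1, q_j) \]
  on the cone of functionals that are positive on \<open>K\<^sub>1\<close>, so it suffices to find a maximum there.
  The function is invariant under scaling of \<open>\<alpha>\<close>, hence it lives on a slice of the cone, the closure
  of which is compact.  A nonzero functional on the boundary of the cone vanishes at some \<open>p\<^sub>i\<close> but
  is positive at every interior point of the convex hull (\<open>functional_pos_at_interior\<close>), in
  particular at all \<open>q\<^sub>j\<close>; so the function tends to \<open>-\<infinity>\<close> there, and the maximum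
  exists (\<open>ratio_attains_max\<close>).  The critical point equation is \<open>balancing_functional_exists\<close>.

  The second sum has the wrong sign for concavity, so there can be several critical points.  This
  happens on the line for \<open>K\<^sub>1 = {-11, 0, 11}\<close> and \<open>K\<^sub>2 = {-9, 9}\<close>, where both the
  identity and \<open>x \<mapsto> x / (99 + x)\<close> equalize the means (\<open>projective_balancing_not_unique\<close>).
\<close>

section \<open>Linear functionals on homogeneous coordinates\<close>

text \<open>
  The coefficients are a function on \<open>nat\<close> and not a finitely supported one, because the product
  topology on functions provides compactness.
\<close>

definition functional :: "nat \<Rightarrow> (nat \<Rightarrow> real) \<Rightarrow> vec \<Rightarrow> real" where
  "functional d f v = (\<Sum>i\<le>d. f i * Poly_Mapping.lookup v i)"

lemma norm_single: "norm (Poly_Mapping.single i t :: vec) = \<bar>t\<bar>"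
  by (simp add: norm_poly_mapping_def dist_poly_mapping_def)

lemma linear_functional: "linear (functional d f)"
  by (rule linearI)
    (simp_all add: functional_def lookup_add lookup_scaleR sum.distrib sum_distrib_left algebra_simps)

lemma functional_scale: "functional d (\<lambda>i. c * f i) v = c * functional d f v"
  by (simp add: functional_def sum_distrib_left mult.assoc)

lemma functional_update:
  assumes "k \<le> d"
  shows "functional d (f(k := f k + t)) v = functional d f v + t * Poly_Mapping.lookup v k"
proof -
  have "(f(k := f k + t)) i * Poly_Mapping.lookup v i =
      f i * Poly_Mapping.lookup v i + (if i = k then t * Poly_Mapping.lookup v k else 0)" for i
    by (simp add: algebra_simps)
  then show ?thesis using assms by (simp add: functional_def sum.distrib)
qed

lemma functional_single:
  "k \<le> d \<Longrightarrow> functional d f (Poly_Mapping.single k c) = f k * c"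
  unfolding functional_def lookup_single
  by (simp add: when_def if_distrib[of "(*) _"] cong: if_cong)

lemma functional_nonzeroD:
  "functional d f v \<noteq> 0 \<Longrightarrow> \<exists>i\<le>d. f i \<noteq> 0"
  unfolding functional_def by (metis (no_types, lifting) atMost_iff mult_zero_left sum.neutral)

lemma continuous_functional: "continuous_on S (\<lambda>f. functional d f v)"
  unfolding functional_def
  by (intro continuous_intros continuous_on_subset[OF continuous_on_product_coordinates]) auto

text \<open>
  A closed subset of a product of compact intervals.  Fixing the coefficients beyond \<open>d\<close> to be zero
  keeps all factors of the product compact.
\<close>

lemma compact_l1_sphere:
  "compact {f :: nat \<Rightarrow> real. (\<forall>i. f i \<in> (if i \<le> d then {-1..1} else {0})) \<and> (\<Sum>i\<le>d. \<bar>f i\<bar>) = 1}"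
proof -
  have "compactin euclidean (PiE UNIV (\<lambda>i. if i \<le> d then {-1..1::real} else {0}))"
    unfolding euclidean_product_topology[symmetric] compactin_PiE by simp
  then have "compact {f. \<forall>i. f i \<in> (if i \<le> d then {-1..1::real} else {0})}"
    by (simp add: PiE_def Pi_def extensional_UNIV)
  moreover have "closed {f :: nat \<Rightarrow> real. (\<Sum>i\<le>d. \<bar>f i\<bar>) = 1}"
    by (intro closed_Collect_eq continuous_intros continuous_on_product_coordinates)
  ultimately show ?thesis
    using compact_Int_closed by (fastforce simp: Collect_conj_eq)
qed

section \<open>The extremal functional\<close>

text \<open>
  With \<open>n = card P\<close> and \<open>m = card Q\<close>, the logarithm of this ratio is \<open>n * m\<close> times the difference of
  the mean logarithms of the values on \<open>P\<close> and on \<open>Q\<close>.  In the multiplicative form the function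
  remains continuous where a value on \<open>P\<close> vanishes.
\<close>

definition ratio :: "nat \<Rightarrow> vec set \<Rightarrow> vec set \<Rightarrow> (nat \<Rightarrow> real) \<Rightarrow> real" where
  "ratio d P Q f = (\<Prod>p\<in>P. functional d f p) ^ card Q / (\<Prod>q\<in>Q. functional d f q) ^ card P"

lemma ratio_scale:
  assumes "c \<noteq> 0"
  shows "ratio d P Q (\<lambda>i. c * f i) = ratio d P Q f"
  using assms
  by (simp add: ratio_def functional_scale prod.distrib power_mult_distrib power_mult[symmetric]
      mult.commute[of "card P"])

lemma ln_ratio:
  assumes "finite P" "finite Q"
    and "\<And>p. p \<in> P \<Longrightarrow> 0 < functional d f p" "\<And>q. q \<in> Q \<Longrightarrow> 0 < functional d f q"
  shows "0 < ratio d P Q f"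
    and "ln (ratio d P Q f) = real (card Q) * (\<Sum>p\<in>P. ln (functional d f p))
           - real (card P) * (\<Sum>q\<in>Q. ln (functional d f q))"
proof -
  have pos: "0 < (\<Prod>p\<in>P. functional d f p)" "0 < (\<Prod>q\<in>Q. functional d f q)"
    using assms by (auto intro: prod_pos)
  then show "0 < ratio d P Q f" by (simp add: ratio_def)
  show "ln (ratio d P Q f) = real (card Q) * (\<Sum>p\<in>P. ln (functional d f p))
           - real (card P) * (\<Sum>q\<in>Q. ln (functional d f q))"
    unfolding ratio_def using pos assms by (simp add: ln_divide_pos ln_realpow ln_prod less_imp_neq[symmetric])
qed

text \<open>
  The maximum over the compact slice of the closed cone exists because \<open>ratio\<close> is continuous: by
  the domination hypothesis \<open>dom\<close> its denominator does not vanish on nonzero elements of the closed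
  cone.  The maximizer lies in the open cone because \<open>ratio\<close> is zero on the boundary but positive
  at \<open>e\<close>.
\<close>

lemma ratio_attains_max:
  assumes fin: "finite P" "finite Q" and ne: "P \<noteq> {}" "Q \<noteq> {}"
    and dom: "\<And>f q. \<exists>i\<le>d. f i \<noteq> 0 \<Longrightarrow> \<forall>p\<in>P. 0 \<le> functional d f p \<Longrightarrow> q \<in> Q
                \<Longrightarrow> 0 < functional d f q"
    and e: "\<And>p. p \<in> P \<Longrightarrow> 0 < functional d e p"
  obtains f where "\<forall>p\<in>P. 0 < functional d f p"
    and "\<And>g. \<forall>p\<in>P. 0 < functional d g p \<Longrightarrow> ratio d P Q g \<le> ratio d P Q f"
proof -
  let ?B = "{f :: nat \<Rightarrow> real. (\<forall>i. f i \<in> (if i \<le> d then {-1..1} else {0})) \<and> (\<Sum>i\<le>d. \<bar>f i\<bar>) = 1}"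
  define S where "S = ?B \<inter> {f. \<forall>p\<in>P. 0 \<le> functional d f p}"
  have "closed {f. \<forall>p\<in>P. 0 \<le> functional d f p}"
    unfolding Collect_ball_eq
    by (intro closed_INT ballI closed_Collect_le continuous_functional continuous_intros)
  then have compact: "compact S" unfolding S_def by (rule compact_Int_closed[OF compact_l1_sphere])
  have posQ: "0 < functional d f q" if "f \<in> S" "q \<in> Q" for f q
  proof (rule dom)
    show "\<exists>i\<le>d. f i \<noteq> 0"
    proof (rule ccontr)
      assume "\<not> (\<exists>i\<le>d. f i \<noteq> 0)"
      then have "(\<Sum>i\<le>d. \<bar>f i\<bar>) = 0" by simp
      then show False using that by (simp add: S_def)
    qed
  qed (use that in \<open>auto simp: S_def\<close>)
  \<comment> \<open>As \<open>ratio\<close> is homogeneous of degree 0, its maximum over the slice is one over the cone.\<close>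
  have normalise: "\<exists>h\<in>S. ratio d P Q h = ratio d P Q g" if g: "\<forall>p\<in>P. 0 < functional d g p" for g
  proof -
    define s where "s = (\<Sum>i\<le>d. \<bar>g i\<bar>)"
    have "\<exists>i\<le>d. g i \<noteq> 0" using g ne(1) functional_nonzeroD[of d g] by fastforce
    then have s: "0 < s" unfolding s_def by (auto intro: sum_pos2)
    have gs: "\<bar>g i\<bar> \<le> s" if "i \<le> d" for i
      unfolding s_def using that by (intro member_le_sum) auto
    define c h where "c = 1 / s" and "h = (\<lambda>i. c * (if i \<le> d then g i else 0))"
    have c: "c > 0" using s by (simp add: c_def)
    have fh: "functional d h v = c * functional d g v" for v
      unfolding functional_def h_def sum_distrib_left by (intro sum.cong) auto
    have "\<bar>h i\<bar> = \<bar>g i\<bar> / s" if "i \<le> d" for i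
      using that s by (simp add: h_def c_def abs_mult)
    then have "(\<Sum>i\<le>d. \<bar>h i\<bar>) = 1"
      using s by (simp add: sum_divide_distrib[symmetric] s_def[symmetric])
    moreover have "h i \<in> (if i \<le> d then {-1..1} else {0})" for i
      using gs[of i] s by (auto simp: h_def c_def divide_simps)
    ultimately have "h \<in> S" using g c unfolding S_def by (simp add: fh less_imp_le)
    moreover have "ratio d P Q h = ratio d P Q (\<lambda>i. c * g i)"
      by (simp add: ratio_def fh functional_scale)
    ultimately show ?thesis using ratio_scale[of c] c by auto
  qed
  have nonempty: "S \<noteq> {}" using normalise[of e] e by blast
  have "continuous_on S (ratio d P Q)"
    unfolding ratio_def
    by (intro continuous_intros continuous_functional) (use posQ fin in \<open>fastforce simp: prod_zero_iff\<close>)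
  then obtain f where f: "f \<in> S" and max: "\<And>h. h \<in> S \<Longrightarrow> ratio d P Q h \<le> ratio d P Q f"
    using continuous_attains_sup[OF compact nonempty] by blast
  have le: "ratio d P Q g \<le> ratio d P Q f" if "\<forall>p\<in>P. 0 < functional d g p" for g
    using normalise[OF that] max by metis
  have "0 < functional d e q" if "q \<in> Q" for q
    using dom[OF _ _ that, of e] e ne(1) functional_nonzeroD[of d e] by (metis ex_in_conv less_le)
  then have "0 < ratio d P Q e" using ln_ratio(1)[OF fin] e by blast
  also have "\<dots> \<le> ratio d P Q f" using le e by blast
  finally have "ratio d P Q f \<noteq> 0" by simp
  then have "functional d f p \<noteq> 0" if "p \<in> P" for p
    using that fin ne(2) by (auto simp: ratio_def prod_zero_iff)
  moreover have "0 \<le> functional d f p" if "p \<in> P" for p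
    using f that by (auto simp: S_def)
  ultimately have "\<forall>p\<in>P. 0 < functional d f p" by (simp add: less_le)
  then show thesis using le that by blast
qed

text \<open>
  The partial derivatives of the logarithm of \<open>ratio\<close> vanish at a maximizer \<open>f\<close>.  The derivative with
  respect to the \<open>k\<close>-th coefficient is, up to the factor \<open>n * m\<close>, the difference of the \<open>k\<close>-th
  coordinates of the two sides of the conclusion.
\<close>

lemma balancing_functional_exists:
  assumes fin: "finite P" "finite Q" and ne: "P \<noteq> {}" "Q \<noteq> {}"
    and hom: "P \<subseteq> homogeneous d" "Q \<subseteq> homogeneous d"
    and dom: "\<And>f q. \<exists>i\<le>d. f i \<noteq> 0 \<Longrightarrow> \<forall>p\<in>P. 0 \<le> functional d f p \<Longrightarrow> q \<in> Q
                \<Longrightarrow> 0 < functional d f q"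
    and e: "\<And>p. p \<in> P \<Longrightarrow> 0 < functional d e p"
  obtains f where "\<And>p. p \<in> P \<Longrightarrow> 0 < functional d f p"
    and "(1 / real (card P)) *\<^sub>R (\<Sum>p\<in>P. (1 / functional d f p) *\<^sub>R p)
       = (1 / real (card Q)) *\<^sub>R (\<Sum>q\<in>Q. (1 / functional d f q) *\<^sub>R q)"
proof -
  obtain f where posP: "\<forall>p\<in>P. 0 < functional d f p"
    and max: "\<And>g. \<forall>p\<in>P. 0 < functional d g p \<Longrightarrow> ratio d P Q g \<le> ratio d P Q f"
    using ratio_attains_max[OF fin ne dom e] by blast
  have posQ': "\<forall>q\<in>Q. 0 < functional d g q" if "\<forall>p\<in>P. 0 < functional d g p" for g
    using dom[of g] that ne(1) functional_nonzeroD[of d g] by (metis ex_in_conv less_le)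
  have posQ: "\<forall>q\<in>Q. 0 < functional d f q" using posQ' posP by blast
  define n m where "n = real (card P)" and "m = real (card Q)"
  have nm: "n > 0" "m > 0" using fin ne by (auto simp: n_def m_def card_gt_0_iff)
  have crit: "(1 / n) * (\<Sum>p\<in>P. Poly_Mapping.lookup p k / functional d f p)
      = (1 / m) * (\<Sum>q\<in>Q. Poly_Mapping.lookup q k / functional d f q)" if k: "k \<le> d" for k
  proof -
    \<comment> \<open>The logarithm of \<open>ratio\<close> along the line through \<open>f\<close> in the \<open>k\<close>-th direction.\<close>
    define F where "F t = m * (\<Sum>p\<in>P. ln (functional d f p + t * Poly_Mapping.lookup p k))
      - n * (\<Sum>q\<in>Q. ln (functional d f q + t * Poly_Mapping.lookup q k))" for t
    have F: "F t = ln (ratio d P Q (f(k := f k + t)))"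
      if "\<forall>p\<in>P. 0 < functional d (f(k := f k + t)) p" for t
      using ln_ratio(2)[OF fin, of d "f(k := f k + t)"] that posQ'[OF that]
      by (simp add: F_def n_def m_def functional_update[OF k])
    have "\<forall>\<^sub>F t in at 0. \<forall>p\<in>P. 0 < functional d f p + t * Poly_Mapping.lookup p k"
    proof (intro eventually_ball_finite[OF fin(1)] ballI)
      fix p assume "p \<in> P"
      have "((\<lambda>t. functional d f p + t * Poly_Mapping.lookup p k) \<longlongrightarrow> functional d f p + 0 * Poly_Mapping.lookup p k) (at 0)"
        by (intro tendsto_intros)
      then show "\<forall>\<^sub>F t in at 0. 0 < functional d f p + t * Poly_Mapping.lookup p k"
        using posP \<open>p \<in> P\<close> by (intro order_tendstoD(1)) auto
    qed
    then obtain \<delta> where \<delta>: "\<delta> > 0"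
      and near: "\<And>t. t \<noteq> 0 \<Longrightarrow> \<bar>t\<bar> < \<delta> \<Longrightarrow> \<forall>p\<in>P. 0 < functional d f p + t * Poly_Mapping.lookup p k"
      unfolding eventually_at by (auto simp: dist_real_def)
    have "F t \<le> F 0" if "\<bar>0 - t\<bar> < \<delta>" for t
    proof -
      have pos: "\<forall>p\<in>P. 0 < functional d (f(k := f k + t)) p"
        using near[of t] that posP by (cases "t = 0") (auto simp: functional_update[OF k])
      have "0 < ratio d P Q (f(k := f k + t))" "0 < ratio d P Q f"
        using ln_ratio(1)[OF fin] pos posQ'[OF pos] posP posQ by blast+
      then show ?thesis using F[OF pos] F[of 0] posP max[OF pos] by simp
    qed
    moreover have "(F has_real_derivative
        m * (\<Sum>p\<in>P. Poly_Mapping.lookup p k / functional d f p)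
        - n * (\<Sum>q\<in>Q. Poly_Mapping.lookup q k / functional d f q)) (at 0)"
      unfolding F_def using posP posQ
      by (auto intro!: derivative_eq_intros simp: divide_simps)
    ultimately have "m * (\<Sum>p\<in>P. Poly_Mapping.lookup p k / functional d f p)
        - n * (\<Sum>q\<in>Q. Poly_Mapping.lookup q k / functional d f q) = 0"
      using \<delta> by (intro DERIV_local_max[of F _ 0 \<delta>]) auto
    then show ?thesis using nm by (simp add: field_simps)
  qed
  have zero: "Poly_Mapping.lookup v k = 0" if "v \<in> homogeneous d" "\<not> k \<le> d" for v k
    using that by (auto simp: homogeneous_def in_keys_iff subset_iff)
  have eq: "(1 / n) *\<^sub>R (\<Sum>p\<in>P. (1 / functional d f p) *\<^sub>R p)
      = (1 / m) *\<^sub>R (\<Sum>q\<in>Q. (1 / functional d f q) *\<^sub>R q)"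
  proof (rule poly_mapping_eqI)
    fix k
    show "Poly_Mapping.lookup ((1 / n) *\<^sub>R (\<Sum>p\<in>P. (1 / functional d f p) *\<^sub>R p)) k
        = Poly_Mapping.lookup ((1 / m) *\<^sub>R (\<Sum>q\<in>Q. (1 / functional d f q) *\<^sub>R q)) k"
    proof (cases "k \<le> d")
      case True
      then show ?thesis using crit by (simp add: lookup_scaleR lookup_sum)
    next
      case False
      then show ?thesis using zero hom by (auto simp: lookup_scaleR lookup_sum subset_iff)
    qed
  qed
  show thesis using that posP eq unfolding n_def m_def by blast
qed

section \<open>Projective transformations with a prescribed denominator\<close>

definition lift :: "vec \<Rightarrow> vec" where
  "lift x = Poly_Mapping.single 0 1 + x"

lemma chart_lift: "chart x = span {lift x}"
  by (simp add: chart_def lift_def)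

lemma subspace_Rd: "subspace (Rd d)"
  by (simp add: subspace_def Rd_def in_keys_iff subset_iff lookup_add lookup_scaleR)
    (metis add.right_neutral)

lemma subspace_homogeneous: "subspace (homogeneous d)"
  by (simp add: subspace_def homogeneous_def in_keys_iff subset_iff lookup_add lookup_scaleR)
    (metis add.right_neutral)

lemma lookup_lift_0: "x \<in> Rd d \<Longrightarrow> Poly_Mapping.lookup (lift x) 0 = 1"
  using lookup_0_Rd[of x d] by (simp add: lift_def lookup_add)

lemma lift_homogeneous: "x \<in> Rd d \<Longrightarrow> lift x \<in> homogeneous d"
  by (auto simp: lift_def homogeneous_def Rd_def in_keys_iff subset_iff lookup_add lookup_single
      when_def simp del: single_one)

lemma lift_nonzero: "x \<in> Rd d \<Longrightarrow> lift x \<noteq> 0"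
  using lookup_lift_0 by fastforce

lemma chart_in_RP: "x \<in> Rd d \<Longrightarrow> chart x \<in> RP d"
  unfolding RP_def chart_lift using lift_homogeneous lift_nonzero by blast

lemma inj_lift: "inj lift"
  by (simp add: lift_def inj_def)

lemma affine_value_eq:
  assumes "\<phi> (chart x) = chart y" "y \<in> Rd d"
  shows "affine_value d \<phi> x = y"
  using assms by (simp add: affine_value_def inv_into_f_f[OF inj_on_chart])

lemma span_singleton_scale: "c \<noteq> 0 \<Longrightarrow> span {c *\<^sub>R v} = span {v :: vec}"
  using span_image_scale[of "{v}" "\<lambda>_. c"] by simp

text \<open>
  In homogeneous coordinates, the transformation sends \<open>(v\<^sub>0, v')\<close> to \<open>(\<alpha> v, v' - v\<^sub>0 c)\<close>.  This map is
  invertible: a vector in its kernel is \<open>v\<^sub>0\<close> times the lift of \<open>c\<close>, and \<open>\<alpha>\<close> vanishes there only for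
  \<open>v\<^sub>0 = 0\<close>.  Taking \<open>c\<close> where \<open>\<alpha>\<close> is nonzero covers the denominators without a constant term, for
  which the simpler choice \<open>(\<alpha> v, v')\<close> is singular.
\<close>

lemma projective_transformation_with_denominator:
  assumes lin: "linear \<alpha>" and c: "c \<in> Rd d" and nz: "\<alpha> (lift c) \<noteq> 0"
  obtains \<phi> where "projective_transformation d \<phi>"
    and "\<And>x. x \<in> Rd d \<Longrightarrow> \<alpha> (lift x) \<noteq> 0 \<Longrightarrow>
      \<phi> (chart x) = chart ((1 / \<alpha> (lift x)) *\<^sub>R (x - c))"
proof -
  define A where "A v = v - Poly_Mapping.lookup v 0 *\<^sub>R lift c + \<alpha> v *\<^sub>R lift 0" for v
  \<comment> \<open>The inverse \<open>B\<close> of \<open>A\<close>; the coordinate \<open>v\<^sub>0\<close> of a preimage \<open>v\<close> of \<open>w\<close> is \<open>s w\<close>, which is found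
    by applying \<open>\<alpha>\<close> to \<open>w = A v\<close>.\<close>
  define s where "s w = (Poly_Mapping.lookup w 0 * (1 + \<alpha> (lift 0)) - \<alpha> w) / \<alpha> (lift c)" for w
  define B where "B w = w - Poly_Mapping.lookup w 0 *\<^sub>R lift 0 + s w *\<^sub>R lift c" for w
  interpret \<alpha>: linear \<alpha> by (rule lin)
  have Rd0: "0 \<in> Rd d" using subspace_Rd subspace_0 by blast
  have l0: "Poly_Mapping.lookup (lift c) 0 = 1" "Poly_Mapping.lookup (lift 0) 0 = 1"
    using lookup_lift_0[OF c] lookup_lift_0[OF Rd0] by auto
  have A0: "Poly_Mapping.lookup (A v) 0 = \<alpha> v" for v
    by (simp add: A_def lookup_add lookup_minus lookup_scaleR l0)
  have B0: "Poly_Mapping.lookup (B w) 0 = s w" for w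
    by (simp add: B_def lookup_add lookup_minus lookup_scaleR l0)
  have linA: "linear A"
    by (rule linearI)
      (simp_all add: A_def lookup_add lookup_scaleR \<alpha>.add \<alpha>.scale algebra_simps)
  have "s (A v) = Poly_Mapping.lookup v 0" for v
  proof -
    have "\<alpha> (A v) = \<alpha> v - Poly_Mapping.lookup v 0 * \<alpha> (lift c) + \<alpha> v * \<alpha> (lift 0)"
      by (simp add: A_def \<alpha>.add \<alpha>.diff \<alpha>.scale)
    then show ?thesis using nz by (simp add: s_def A0 field_simps)
  qed
  then have BA: "B (A v) = v" for v
    by (simp add: B_def A0) (simp add: A_def)
  have "\<alpha> (B w) = Poly_Mapping.lookup w 0" for w
    using nz by (simp add: B_def \<alpha>.add \<alpha>.diff \<alpha>.scale s_def field_simps)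
  then have AB: "A (B w) = w" for w
    by (simp add: A_def B0) (simp add: B_def)
  have "lift c \<in> homogeneous d" "lift 0 \<in> homogeneous d"
    using lift_homogeneous c Rd0 by blast+
  then have "A v \<in> homogeneous d" "B v \<in> homogeneous d" if "v \<in> homogeneous d" for v
    using that subspace_homogeneous[of d] unfolding A_def B_def
    by (blast intro: subspace_add subspace_diff subspace_scale)+
  then have bij: "bij_betw A (homogeneous d) (homogeneous d)"
    by (intro bij_betwI[of _ _ _ B]) (auto simp: AB BA)
  show thesis
  proof
    show "projective_transformation d ((`) A)"
      unfolding projective_transformation_def using linA bij by blast
    fix x assume x: "x \<in> Rd d" and \<alpha>x: "\<alpha> (lift x) \<noteq> 0"
    have "A (lift x) = \<alpha> (lift x) *\<^sub>R lift ((1 / \<alpha> (lift x)) *\<^sub>R (x - c))"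
      using \<alpha>x by (simp add: A_def lookup_lift_0[OF x]) (simp add: lift_def algebra_simps)
    then show "A ` chart x = chart ((1 / \<alpha> (lift x)) *\<^sub>R (x - c))"
      using \<alpha>x by (simp add: chart_lift linear_span_image[OF linA, symmetric] span_singleton_scale)
  qed
qed

section \<open>Equalizing the means\<close>

text \<open>Used with \<open>I\<close> a closed or an open half line, so that sign conditions extend to the hull.\<close>

lemma functional_lift_convex_hull:
  assumes lin: "linear \<alpha>" and K: "\<And>p. p \<in> K \<Longrightarrow> \<alpha> (lift p) \<in> I" and I: "convex I"
    and x: "x \<in> convex hull K"
  shows "\<alpha> (lift x) \<in> I"
proof -
  define \<beta> where "\<beta> = \<alpha> (Poly_Mapping.single 0 1)"
  have eq: "\<alpha> (lift x) = \<beta> + \<alpha> x" for x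
    using linear_add[OF lin] by (simp add: lift_def \<beta>_def)
  have "{x. \<beta> + \<alpha> x \<in> I} = \<alpha> -` ((+) (- \<beta>) ` I)"
    by (force simp: image_iff)
  then have "convex {x. \<beta> + \<alpha> x \<in> I}"
    by (simp only: convex_linear_vimage[OF lin convex_translation[OF I]])
  then have "convex hull K \<subseteq> {x. \<beta> + \<alpha> x \<in> I}"
    using K by (intro hull_minimal) (auto simp: eq)
  then show ?thesis using x by (auto simp: eq)
qed

text \<open>
  An affine function that is nonnegative on a neighbourhood of \<open>q\<close> and zero at \<open>q\<close> cannot change in
  any direction, so it is the zero function.
\<close>

lemma functional_pos_at_interior:
  assumes K: "\<And>p. p \<in> K \<Longrightarrow> 0 \<le> functional d f (lift p)"
    and q: "q \<in> (top_of_set (Rd d)) interior_of (convex hull K)"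
    and f: "\<exists>i\<le>d. f i \<noteq> 0"
  shows "0 < functional d f (lift q)"
proof (rule ccontr)
  have nonneg: "0 \<le> functional d f (lift x)" if "x \<in> convex hull K" for x
    using functional_lift_convex_hull[OF linear_functional, of K d f "{0..}" x] K that by auto
  assume "\<not> 0 < functional d f (lift q)"
  moreover have "0 \<le> functional d f (lift q)"
    using nonneg[OF subsetD[OF interior_of_subset q]] .
  ultimately have q0: "functional d f (lift q) = 0" by simp
  obtain T where T: "openin (top_of_set (Rd d)) T" "T \<subseteq> convex hull K" "q \<in> T"
    using q unfolding interior_of_def by blast
  then obtain e where e: "e > 0" and ball: "\<And>x. x \<in> Rd d \<Longrightarrow> dist x q < e \<Longrightarrow> x \<in> T"
    unfolding openin_euclidean_subtopology_iff by blast
  have qRd: "q \<in> Rd d" using T openin_imp_subset by blast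
  have fi: "f i = 0" if i: "i \<in> {1..d}" for i
  proof -
    have "0 \<le> f i * t" if t: "\<bar>t\<bar> < e" for t
    proof -
      have "Poly_Mapping.single i t \<in> Rd d" using i by (auto simp: Rd_def)
      then have "q + Poly_Mapping.single i t \<in> Rd d"
        using qRd subspace_add[OF subspace_Rd] by blast
      moreover have "dist (q + Poly_Mapping.single i t) q < e"
        using t by (simp add: dist_norm norm_single)
      ultimately have "0 \<le> functional d f (lift (q + Poly_Mapping.single i t))"
        using ball T(2) nonneg by blast
      also have "lift (q + Poly_Mapping.single i t) = lift q + Poly_Mapping.single i t"
        by (simp add: lift_def algebra_simps)
      finally show ?thesis
        using q0 i by (simp add: linear_add[OF linear_functional] functional_single)
    qed
    from this[of "e / 2"] this[of "- e / 2"] show ?thesis using e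
      by (simp add: zero_le_mult_iff mult_le_0_iff)
  qed
  have "functional d f (lift q) = f 0 * Poly_Mapping.lookup (lift q) 0"
    unfolding functional_def by (subst sum.remove[of _ 0]) (auto intro!: sum.neutral simp: fi)
  then have "f 0 = 0" using q0 lookup_lift_0[OF qRd] by simp
  with fi f show False by (metis Suc_leI atLeastAtMost_iff bot_nat_0.not_eq_extremum One_nat_def)
qed

text \<open>
  A balancing functional \<open>f\<close> for the lifted sets is the denominator of the transformation
  \<open>x \<mapsto> (x - c) / f(1, x)\<close>.  Its values are the images of the vectors \<open>(1, x) / f(1, x)\<close> under a fixed
  linear map, so the balance of the latter carries over to the former.
\<close>

lemma projective_means_agree:
  assumes nested: "nested_sets d K1 K2"
  shows "\<exists>\<phi>. projective_transformation d \<phi> \<and>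
                 admissible d \<phi> K1 \<and> admissible d \<phi> K2 \<and>
                 image_mean d \<phi> K1 = image_mean d \<phi> K2"
proof -
  have fin: "finite K1" "finite K2" and Rd: "K1 \<subseteq> Rd d" "K2 \<subseteq> Rd d" and ne: "K2 \<noteq> {}"
    and int: "K2 \<subseteq> (top_of_set (Rd d)) interior_of (convex hull K1)"
    using nested by (auto simp: nested_sets_def)
  have K2hull: "K2 \<subseteq> convex hull K1" by (rule subset_trans[OF int interior_of_subset])
  then have ne1: "K1 \<noteq> {}" using ne by auto
  have inj: "inj_on lift K" for K using inj_lift inj_on_subset by blast
  \<comment> \<open>The constant function 1 is a functional in the open cone.\<close>
  have e: "functional d (\<lambda>i. if i = 0 then 1 else 0) (lift p) = 1" if "p \<in> K1" for p
    using lookup_lift_0[of p d] that Rd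
    by (auto simp: functional_def if_distrib[of "\<lambda>x. x * _"] cong: if_cong)
  obtain f where pos: "\<And>p. p \<in> lift ` K1 \<Longrightarrow> 0 < functional d f p"
    and bal: "(1 / real (card (lift ` K1))) *\<^sub>R (\<Sum>p\<in>lift ` K1. (1 / functional d f p) *\<^sub>R p)
       = (1 / real (card (lift ` K2))) *\<^sub>R (\<Sum>q\<in>lift ` K2. (1 / functional d f q) *\<^sub>R q)"
  proof (rule balancing_functional_exists)
    show "lift ` K1 \<subseteq> homogeneous d" "lift ` K2 \<subseteq> homogeneous d"
      using Rd lift_homogeneous by blast+
    show "0 < functional d f q" if "\<exists>i\<le>d. f i \<noteq> 0" "\<forall>p\<in>lift ` K1. 0 \<le> functional d f p" "q \<in> lift ` K2" for f q
      using that int functional_pos_at_interior[of K1 d f] by blast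
    show "0 < functional d (\<lambda>i. if i = 0 then 1 else 0) p" if "p \<in> lift ` K1" for p
      using e that by force
  qed (use fin ne ne1 in auto)
  let ?\<alpha> = "\<lambda>x. functional d f (lift x)"
  have posh: "0 < ?\<alpha> x" if "x \<in> convex hull K1" for x
    using functional_lift_convex_hull[OF linear_functional, of K1 d f "{0<..}" x] pos that by auto
  obtain c where c: "c \<in> K1" using ne1 by blast
  then have cRd: "c \<in> Rd d" "?\<alpha> c \<noteq> 0" using Rd pos by force+
  obtain \<phi> where \<phi>: "projective_transformation d \<phi>"
    and val: "\<And>x. x \<in> Rd d \<Longrightarrow> ?\<alpha> x \<noteq> 0 \<Longrightarrow> \<phi> (chart x) = chart ((1 / ?\<alpha> x) *\<^sub>R (x - c))"
    using projective_transformation_with_denominator[OF linear_functional cRd] by blast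
  have hullRd: "convex hull K1 \<subseteq> Rd d"
    using hull_minimal[of K1 "Rd d" convex] Rd(1) subspace_imp_convex[OF subspace_Rd] by blast
  have img: "(1 / ?\<alpha> x) *\<^sub>R (x - c) \<in> Rd d" if "x \<in> Rd d" for x
    using that cRd(1) subspace_Rd[of d] by (blast intro: subspace_diff subspace_scale)
  have adm: "admissible d \<phi> K" if "K \<subseteq> convex hull K1" for K
  proof -
    have "convex hull K \<subseteq> convex hull K1" using that by (simp add: hull_minimal)
    then show ?thesis unfolding admissible_def
      using posh val img hullRd by (fastforce simp: image_iff)
  qed
  \<comment> \<open>The linear map that sends \<open>lift x\<close> to \<open>x - c\<close>.\<close>
  define L where "L v = v - Poly_Mapping.lookup v 0 *\<^sub>R lift c" for v
  have L: "linear L" unfolding L_def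
    by (rule linearI) (simp_all add: lookup_add lookup_scaleR algebra_simps)
  have mean: "image_mean d \<phi> K
      = L ((1 / real (card (lift ` K))) *\<^sub>R (\<Sum>p\<in>lift ` K. (1 / functional d f p) *\<^sub>R p))"
    if K: "K \<subseteq> convex hull K1" for K
  proof -
    have "affine_value d \<phi> x = L ((1 / ?\<alpha> x) *\<^sub>R lift x)" if "x \<in> K" for x
    proof -
      have x: "x \<in> Rd d" "?\<alpha> x \<noteq> 0" using K that hullRd posh by force+
      then have "affine_value d \<phi> x = (1 / ?\<alpha> x) *\<^sub>R (x - c)"
        using val img by (intro affine_value_eq)
      also have "x - c = L (lift x)"
        using lookup_lift_0[OF x(1)] by (simp add: L_def) (simp add: lift_def)
      finally show ?thesis using linear_scale[OF L] by simp
    qed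
    then show ?thesis
      by (simp add: image_mean_def card_image[OF inj] sum.reindex[OF inj] linear_scale[OF L] linear_sum[OF L])
  qed
  have "image_mean d \<phi> K1 = image_mean d \<phi> K2"
    using mean[OF hull_subset] mean[OF K2hull] bal by simp
  then show ?thesis using \<phi> adm[OF hull_subset] adm[OF K2hull] by blast
qed

section \<open>Two inequivalent transformations on the line\<close>

definition pt :: "real \<Rightarrow> vec" where
  "pt r = Poly_Mapping.single 1 r"

lemma lookup_pt: "Poly_Mapping.lookup (pt r) i = (if i = 1 then r else 0)"
  by (simp add: pt_def lookup_single when_def)

lemma pt_Rd: "pt r \<in> Rd 1"
  by (auto simp: Rd_def in_keys_iff lookup_pt split: if_splits)

lemma Rd_1_eq_pt: "x \<in> Rd 1 \<Longrightarrow> \<exists>r. x = pt r"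
  by (rule exI[of _ "Poly_Mapping.lookup x 1"], rule poly_mapping_eqI)
    (auto simp: Rd_def lookup_pt in_keys_iff)

lemma pt_0: "pt 0 = 0"
  by (simp add: pt_def)

lemma pt_add: "pt r + pt t = pt (r + t)"
  by (simp add: pt_def single_add)

lemma pt_scaleR: "c *\<^sub>R pt r = pt (c * r)"
  by (rule poly_mapping_eqI) (simp add: lookup_scaleR lookup_pt)

lemma dist_pt: "dist (pt r) (pt t) = \<bar>r - t\<bar>"
  by (simp add: pt_def dist_norm single_diff[symmetric] norm_single)

lemma inj_pt: "inj pt"
  by (metis injI lookup_pt)

lemma convex_hull_pts:
  assumes "a < b" "pt a \<in> K" "pt b \<in> K" "a \<le> r" "r \<le> b"
  shows "pt r \<in> convex hull K"
proof -
  define u where "u = (r - a) / (b - a)"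
  have u: "0 \<le> u" "u \<le> 1" using assms by (auto simp: u_def)
  have "u * (b - a) = r - a" using assms(1) by (simp add: u_def)
  then have "r = (1 - u) * a + u * b" by (simp add: algebra_simps)
  then have "pt r = (1 - u) *\<^sub>R pt a + u *\<^sub>R pt b"
    by (simp add: pt_scaleR pt_add)
  moreover have "(1 - u) *\<^sub>R pt a + u *\<^sub>R pt b \<in> convex hull K"
    using u assms(2,3) by (intro convexD convex_convex_hull) (auto intro: hull_inc)
  ultimately show ?thesis by simp
qed

lemma pt_in_interior:
  assumes "pt a \<in> K" "pt b \<in> K" "a < r" "r < b"
  shows "pt r \<in> (top_of_set (Rd 1)) interior_of (convex hull K)"
proof -
  define T where "T = {x \<in> Rd 1. dist x (pt r) < min (r - a) (b - r)}"
  have "openin (top_of_set (Rd 1)) T"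
  proof -
    have "T = Rd 1 \<inter> ball (pt r) (min (r - a) (b - r))" by (auto simp: T_def dist_commute)
    then show ?thesis by auto
  qed
  moreover have "pt r \<in> T" using assms pt_Rd by (simp add: T_def)
  moreover have "x \<in> convex hull K" if xT: "x \<in> T" for x
  proof -
    obtain t where x: "x = pt t" using xT Rd_1_eq_pt unfolding T_def by blast
    then have "a \<le> t" "t \<le> b" using xT unfolding T_def x by (auto simp: dist_pt)
    then show ?thesis using convex_hull_pts[of a b K t] assms x by simp
  qed
  ultimately show ?thesis unfolding interior_of_def by blast
qed

lemma image_mean_pt:
  assumes "\<And>r. r \<in> X \<Longrightarrow> affine_value d \<phi> (pt r) = pt (h r)"
  shows "image_mean d \<phi> (pt ` X) = pt ((\<Sum>r\<in>X. h r) / real (card X))"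
proof -
  have "linear pt" by (rule linearI) (simp_all add: pt_add pt_scaleR)
  then show ?thesis
    using assms inj_on_subset[OF inj_pt, of X]
    by (simp add: image_mean_def sum.reindex card_image linear_sum[symmetric] pt_scaleR)
qed

text \<open>
  For \<open>K\<^sub>1 = {-a, 0, a}\<close> and \<open>K\<^sub>2 = {-b, b}\<close> the identity equalizes the means by symmetry.
  With a denominator \<open>1 + s x\<close> where \<open>s \<noteq> 0\<close>, the means of \<open>x / (1 + s x)\<close> agree iff those of
  \<open>1 / (1 + s x)\<close> do, that is, iff
  \[ \frac13 \Bigl(1 + \frac{2}{1 - s^2 a^2}\Bigr) = \frac{1}{1 - s^2 b^2}. \]
  The nonzero solutions satisfy \<open>s\<^sup>2 = (3 b\<^sup>2 - 2 a\<^sup>2) / (a b)\<^sup>2\<close>.  For \<open>a = 11\<close> and \<open>b = 9\<close> this is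
  \<open>1 / 99\<^sup>2\<close>, and scaling the denominator by 99 gives \<open>99 + x\<close>.
\<close>

lemma projective_balancing_not_unique:
  "\<exists>d K1 K2 \<phi> \<psi>. nested_sets d K1 K2 \<and>
            projective_transformation d \<phi> \<and> projective_transformation d \<psi> \<and>
            admissible d \<phi> K1 \<and> admissible d \<psi> K1 \<and>
            image_mean d \<phi> K1 = image_mean d \<phi> K2 \<and>
            image_mean d \<psi> K1 = image_mean d \<psi> K2 \<and>
            \<not> affine_transformation d (\<phi> \<circ> inv_into (RP d) \<psi>)"
proof -
  define K1 where "K1 = pt ` {-11, 0, 11}"
  define K2 where "K2 = pt ` {-9, 9}"
  have Rd: "K1 \<subseteq> Rd 1" "K2 \<subseteq> Rd 1" using pt_Rd by (auto simp: K1_def K2_def)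
  have int: "K2 \<subseteq> (top_of_set (Rd 1)) interior_of (convex hull K1)"
    unfolding K2_def using pt_in_interior[of "-11" K1 11] by (auto simp: K1_def)
  have nested: "nested_sets 1 K1 K2"
    using Rd int by (simp add: nested_sets_def) (simp add: K1_def K2_def)
  have hullRd: "convex hull K1 \<subseteq> Rd 1"
    using hull_minimal[of K1 "Rd 1" convex] Rd(1) subspace_imp_convex[OF subspace_Rd] by blast
  define \<psi> :: "vec set \<Rightarrow> vec set" where "\<psi> P = P" for P
  have \<psi>: "projective_transformation 1 \<psi>"
    unfolding projective_transformation_def \<psi>_def
    by (rule exI[of _ "\<lambda>x. x"]) (auto simp: linear_id[unfolded id_def] bij_betw_def)
  have \<psi>adm: "admissible 1 \<psi> K1" using hullRd by (auto simp: admissible_def \<psi>_def)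
  have \<psi>val: "affine_value 1 \<psi> (pt r) = pt r" for r
    using pt_Rd by (intro affine_value_eq) (auto simp: \<psi>_def)
  have "image_mean 1 \<psi> (pt ` X) = pt ((\<Sum>r\<in>X. r) / real (card X))" for X
    by (rule image_mean_pt) (rule \<psi>val)
  then have \<psi>mean: "image_mean 1 \<psi> K1 = image_mean 1 \<psi> K2"
    unfolding K1_def K2_def by (simp only:) simp
  define \<alpha> :: "vec \<Rightarrow> real" where
    "\<alpha> v = 99 * Poly_Mapping.lookup v 0 + Poly_Mapping.lookup v 1" for v
  have \<alpha>: "linear \<alpha>"
    by (rule linearI) (simp_all add: \<alpha>_def lookup_add lookup_scaleR algebra_simps)
  have \<alpha>pt: "\<alpha> (lift (pt r)) = 99 + r" for r
    by (simp add: \<alpha>_def lift_def lookup_add lookup_pt lookup_single when_def del: single_one)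
  have "\<alpha> (lift 0) \<noteq> 0" using \<alpha>pt[of 0] by (simp add: pt_0)
  moreover have "0 \<in> Rd 1" using subspace_Rd subspace_0 by blast
  ultimately obtain \<phi> where \<phi>: "projective_transformation 1 \<phi>"
    and \<phi>ch: "\<And>x. x \<in> Rd 1 \<Longrightarrow> \<alpha> (lift x) \<noteq> 0 \<Longrightarrow>
      \<phi> (chart x) = chart ((1 / \<alpha> (lift x)) *\<^sub>R (x - 0))"
    using projective_transformation_with_denominator[OF \<alpha>] by blast
  have \<phi>pt: "\<phi> (chart (pt r)) = chart (pt (r / (99 + r)))" if "r > - 99" for r
    using \<phi>ch[OF pt_Rd, of r] that by (simp add: \<alpha>pt pt_scaleR)
  have \<phi>val: "affine_value 1 \<phi> (pt r) = pt (r / (99 + r))" if "r > - 99" for r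
    using pt_Rd \<phi>pt[OF that] by (intro affine_value_eq)
  have \<phi>adm: "admissible 1 \<phi> K1"
    unfolding admissible_def
  proof (clarify)
    fix x assume x: "x \<in> convex hull K1"
    then obtain r where r: "x = pt r" using hullRd Rd_1_eq_pt by blast
    have "\<alpha> (lift x) \<in> {0<..}"
      by (rule functional_lift_convex_hull[OF \<alpha> _ _ x]) (auto simp: K1_def \<alpha>pt)
    then have "r > - 99" by (simp add: r \<alpha>pt)
    then show "\<phi> (chart x) \<in> chart ` Rd 1" using \<phi>pt pt_Rd r by simp
  qed
  have \<phi>meanX: "image_mean 1 \<phi> (pt ` X) = pt ((\<Sum>r\<in>X. r / (99 + r)) / real (card X))"
    if "X \<subseteq> {- 99<..}" for X
    using that by (intro image_mean_pt \<phi>val) auto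
  have \<phi>mean: "image_mean 1 \<phi> K1 = image_mean 1 \<phi> K2"
    unfolding K1_def K2_def by (subst (1 2) \<phi>meanX) simp_all
  have "\<not> affine_transformation 1 (\<phi> \<circ> inv_into (RP 1) \<psi>)"
  proof
    assume "affine_transformation 1 (\<phi> \<circ> inv_into (RP 1) \<psi>)"
    then obtain A b where A: "linear A" "bij_betw A (Rd 1) (Rd 1)" and b: "b \<in> Rd 1"
      and eq: "\<And>x. x \<in> Rd 1 \<Longrightarrow> (\<phi> \<circ> inv_into (RP 1) \<psi>) (chart x) = chart (A x + b)"
      unfolding affine_transformation_def by blast
    have "inv_into (RP 1) \<psi> P = P" if "P \<in> RP 1" for P
      using f_inv_into_f[of P \<psi> "RP 1"] that by (simp add: \<psi>_def image_def)
    then have "\<phi> (chart x) = chart (A x + b)" if "x \<in> Rd 1" for x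
      using eq[OF that] chart_in_RP[OF that] by simp
    then have "chart (pt (r / (99 + r))) = chart (A (pt r) + b)" if "r > - 99" for r
      using \<phi>pt[OF that] pt_Rd by metis
    moreover have "A (pt r) + b \<in> Rd 1" for r
      using A(2) b pt_Rd subspace_add[OF subspace_Rd] by (blast dest: bij_betwE)
    ultimately have Apt: "pt (r / (99 + r)) = A (pt r) + b" if "r > - 99" for r
      using inj_onD[OF inj_on_chart[of 1]] pt_Rd that by metis
    \<comment> \<open>An affine map would preserve the midpoint of \<open>-11\<close> and \<open>11\<close>.\<close>
    have "A (pt (-11)) + A (pt 11) = 2 *\<^sub>R A (pt 0)"
      using linear_0[OF A(1)] by (simp add: linear_add[OF A(1), symmetric] pt_add pt_0)
    then have "(A (pt (-11)) + b) + (A (pt 11) + b) = 2 *\<^sub>R (A (pt 0) + b)"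
      by (simp add: algebra_simps scaleR_2)
    then have "pt (-1/8) + pt (1/10) = 2 *\<^sub>R pt 0"
      using Apt[of "-11"] Apt[of 11] Apt[of 0] by simp
    then have "pt (-1/8 + 1/10) = pt 0" by (simp only: pt_add pt_scaleR mult_zero_right)
    then have "-1/8 + 1/10 = (0::real)" using injD[OF inj_pt] by blast
    then show False by simp
  qed
  then show ?thesis using nested \<phi> \<psi> \<phi>adm \<psi>adm \<phi>mean \<psi>mean by blast
qed

theorem theorem3:
  shows "(\<forall>d K1 K2. nested_sets d K1 K2 \<longrightarrow>
            (\<exists>\<phi>. projective_transformation d \<phi> \<and>
                 admissible d \<phi> K1 \<and> admissible d \<phi> K2 \<and>
                 image_mean d \<phi> K1 = image_mean d \<phi> K2))
       \<and> (\<exists>d K1 K2 \<phi> \<psi>. nested_sets d K1 K2 \<and>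
            projective_transformation d \<phi> \<and> projective_transformation d \<psi> \<and>
            admissible d \<phi> K1 \<and> admissible d \<psi> K1 \<and>
            image_mean d \<phi> K1 = image_mean d \<phi> K2 \<and>
            image_mean d \<psi> K1 = image_mean d \<psi> K2 \<and>
            \<not> affine_transformation d (\<phi> \<circ> inv_into (RP d) \<psi>))"
  using projective_means_agree projective_balancing_not_unique by blast

end
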